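(* Let $n\ge2$, let $u(t)$ be a univariate real polynomial which is nonnegative on $[-1,1]$, let $(Y,W_Y)$ be a quadrature rule on $S^{n-1}$, and let $f$ be a real-valued function on $S^{n-1}$. If $f$ is nonnegative at the points of $Y$, then the approximate convolution \[ \widetilde{T_u(f)}(x)=\sum_{y_i\in Y}W_Y(y_i)\,u(\langle x,y_i\rangle)\,f(y_i) \] is a sum of squares in $\mathbb{R}[S^{n-1}]$.
   Context: $S^{n-1}\subset\mathbb{R}^n$ is the unit sphere and $\mathbb{R}[S^{n-1}]$ is the ring of restrictions to $S^{n-1}$ of real polynomials in $n$ variables; a sum of squares in this ring is a finite sum of squares of its elements. A quadrature rule on $S^{n-1}$ is a pair $(Y,W_Y)$ consisting of a finite set $Y\subset S^{n-1}$ and a positive weight function $W_Y:Y\to\mathbb{R}_{>0}$. *)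

theory Defs
  imports "HOL-Analysis.Analysis" "HOL-Computational_Algebra.Polynomial"
begin

text \<open>Functions on the unit sphere of \<open>real ^ 'n\<close> are represented by extensional functions on
  \<open>sphere 0 1\<close> (value \<open>undefined\<close> off the sphere), so that equality of elements of the coordinate
  ring is equality of functions on the sphere. Since every linear map on \<open>real ^ 'n\<close> is bounded,
  \<open>real_polynomial_function\<close> holds exactly of the functions given by real polynomials in the
  \<open>CARD('n)\<close> coordinates.\<close>

definition sphere_ring :: "(real ^ 'n \<Rightarrow> real) set" where
  "sphere_ring = {restrict p (sphere 0 1) | p. real_polynomial_function p}"

definition sphere_sos :: "(real ^ 'n \<Rightarrow> real) \<Rightarrow> bool" where
  "sphere_sos h \<longleftrightarrow>
     (\<exists>(m::nat) g. (\<forall>i<m. g i \<in> sphere_ring) \<and> h = (\<lambda>x\<in>sphere 0 1. \<Sum>i<m. (g i x)\<^sup>2))"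

text \<open>The weight is a total function of which only the values on \<open>Y\<close> are relevant.\<close>

definition quadrature_rule :: "(real ^ 'n) set \<Rightarrow> (real ^ 'n \<Rightarrow> real) \<Rightarrow> bool" where
  "quadrature_rule Y W \<longleftrightarrow> finite Y \<and> Y \<subseteq> sphere 0 1 \<and> (\<forall>y\<in>Y. W y > 0)"

definition approx_convolution ::
  "(real ^ 'n) set \<Rightarrow> (real ^ 'n \<Rightarrow> real) \<Rightarrow> real poly \<Rightarrow> (real ^ 'n \<Rightarrow> real) \<Rightarrow> real ^ 'n \<Rightarrow> real"
  where
  "approx_convolution Y W u f = (\<lambda>x\<in>sphere 0 1. \<Sum>y\<in>Y. W y * poly u (x \<bullet> y) * f y)"

end

theory Submission imports Defs begin

text \<open>For \<open>x\<close>, \<open>y\<close> on the sphere, \<open>2 * (1 - x \<bullet> y)\<close> and \<open>2 * (1 + x \<bullet> y)\<close> are the sums of squares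
  \<open>\<Sum>i. (x $ i - y $ i)\<^sup>2\<close> and \<open>\<Sum>i. (x $ i + y $ i)\<^sup>2\<close>. Sums of squares form a semiring, so it is
  enough that every polynomial that is nonnegative on \<open>[-1, 1]\<close> lies in the semiring generated by
  the nonnegative constants, the squares, \<open>1 - t\<close> and \<open>1 + t\<close>. To see this, subtract the minimum,
  so that the polynomial acquires a zero in \<open>[-1, 1]\<close>: at an end point a factor \<open>1 - t\<close> or \<open>1 + t\<close>
  splits off, at an interior point \<open>a\<close> the zero is double and \<open>(t - a)\<^sup>2\<close> splits off. The cofactor is
  again nonnegative and has smaller degree.\<close>

text \<open>A factorization says nothing about the sign of the cofactor at the zero divided out.
  Continuity supplies it, since \<open>c < d\<close> makes \<open>a\<close> a limit point of the
  interval, even when \<open>a\<close> is an end point.\<close>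

lemma poly_nonneg_Icc_fill:
  fixes q :: "real poly"
  assumes "c < d" "a \<in> {c..d}" and nonneg: "\<And>t. t \<in> {c..d} - {a} \<Longrightarrow> 0 \<le> poly q t"
  shows "0 \<le> poly q a"
proof (rule tendsto_lowerbound)
  show "(poly q \<longlongrightarrow> poly q a) (at a within {c..d})"
    by (intro tendsto_intros)
  show "\<forall>\<^sub>F t in at a within {c..d}. 0 \<le> poly q t"
    unfolding eventually_at_filter using nonneg by (auto intro!: always_eventually)
  show "at a within {c..d} \<noteq> bot"
    using assms(1,2) by (auto simp: trivial_limit_within islimpt_Icc)
qed

text \<open>As an induction rule, the decomposition applies to any predicate with these closure
  properties. The factors \<open>t - c\<close> and \<open>d - t\<close> only ever multiply a
  cofactor, so \<open>P\<close> need not be closed under general products.\<close>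

lemma poly_nonneg_Icc_induct [consumes 2, case_names const add square left right]:
  fixes u :: "real poly"
  assumes "c < d" and nonneg: "\<forall>t\<in>{c..d}. 0 \<le> poly u t"
    and const: "\<And>k. 0 \<le> k \<Longrightarrow> P [:k:]"
    and add: "\<And>p q. P p \<Longrightarrow> P q \<Longrightarrow> P (p + q)"
    and square: "\<And>p q. P q \<Longrightarrow> P (p\<^sup>2 * q)"
    and left: "\<And>q. P q \<Longrightarrow> P ([:- c, 1:] * q)"
    and right: "\<And>q. P q \<Longrightarrow> P ([:d, - 1:] * q)"
  shows "P u"
  using nonneg
proof (induction "degree u" arbitrary: u rule: less_induct)
  case less
  show ?case
  proof (cases "degree u = 0")
    case True
    then obtain k where "u = [:k:]"
      by (rule degree_eq_zeroE)
    moreover have "0 \<le> poly u c"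
      using less.prems \<open>c < d\<close> by simp
    ultimately show ?thesis
      using const by simp
  next
    case False
    obtain a where a: "a \<in> {c..d}" and min: "\<And>t. t \<in> {c..d} \<Longrightarrow> poly u a \<le> poly u t"
      using continuous_attains_inf[of "{c..d}" "poly u"] \<open>c < d\<close>
      by (auto simp: continuous_on_poly[OF continuous_on_id] intro: continuous_intros)
    define v where "v = u - [:poly u a:]"
    have v_nonneg: "0 \<le> poly v t" if "t \<in> {c..d}" for t
      using min[OF that] by (simp add: v_def)
    have u: "u = [:poly u a:] + v"
      by (simp add: v_def)
    \<comment> \<open>Removing a constant keeps a positive degree, so each cofactor of
      \<open>v\<close> has smaller degree than \<open>u\<close> and the induction hypothesis
      applies.\<close>
    have "degree v = degree u"
      using False degree_add_eq_left[of "- [:poly u a:]" u]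
      by (simp add: v_def diff_conv_add_uminus del: add_uminus_conv_diff)
    have "poly v a = 0"
      by (simp add: v_def)
    then obtain q where q: "v = [:- a, 1:] * q"
      by (auto simp: poly_eq_0_iff_dvd elim: dvdE)
    have "v \<noteq> 0"
      using False \<open>degree v = degree u\<close> by auto
    then have "q \<noteq> 0"
      using q by auto
    then have deg_q: "degree u = Suc (degree q)"
      unfolding \<open>degree v = degree u\<close>[symmetric] q by (subst degree_mult_eq) auto
    have v_eq: "poly v t = (t - a) * poly q t" for t
      by (simp add: q algebra_simps)
    have q_right: "0 \<le> poly q t" if "a < t" "t \<le> d" for t
      using v_nonneg[of t] that a by (simp add: v_eq zero_le_mult_iff)
    have q_left: "poly q t \<le> 0" if "c \<le> t" "t < a" for t
      using v_nonneg[of t] that a by (simp add: v_eq zero_le_mult_iff)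
    \<comment> \<open>Each one-sided limit exists only if there is room on that side of
      \<open>a\<close>. At an interior \<open>a\<close> both apply and force \<open>q\<close> to
      vanish, which makes the zero of \<open>v\<close> double.\<close>
    have qa_nonneg: "0 \<le> poly q a" if "a < d"
      by (rule poly_nonneg_Icc_fill[of a d]) (use that q_right in auto)
    have qa_nonpos: "poly q a \<le> 0" if "c < a"
      using poly_nonneg_Icc_fill[of c a a "- q"] that q_left by force
    consider "a = c" | "a = d" | "c < a" "a < d"
      using a by fastforce
    then have "P v"
    proof cases
      case 1
      then have "P q"
        using less.hyps[of q] deg_q q_right qa_nonneg \<open>c < d\<close> by (force simp: le_less)
      with left 1 q show ?thesis
        by simp
    next
      case 2
      \<comment> \<open>To the left of \<open>d\<close> the factor \<open>t - d\<close> is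
        nonpositive, so the nonnegative cofactor is \<open>- q\<close>, paired with
        \<open>d - t\<close>.\<close>
      then have "P (- q)"
        using less.hyps[of "- q"] deg_q q_left qa_nonpos \<open>c < d\<close> by (force simp: le_less)
      then have "P ([:d, - 1:] * - q)"
        by (rule right)
      also have "[:d, - 1:] * - q = v"
        using 2 q by simp
      finally show ?thesis .
    next
      case 3
      then have "poly q a = 0"
        using qa_nonneg qa_nonpos by simp
      then obtain r where r: "q = [:- a, 1:] * r"
        by (auto simp: poly_eq_0_iff_dvd elim: dvdE)
      have "r \<noteq> 0"
        using \<open>q \<noteq> 0\<close> r by auto
      then have deg_r: "degree q = Suc (degree r)"
        unfolding r by (subst degree_mult_eq) auto
      have v_sq: "v = [:- a, 1:]\<^sup>2 * r"
        by (simp only: q r power2_eq_square mult.assoc)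
      have r_nonneg: "0 \<le> poly r t" if "t \<in> {c..d} - {a}" for t
      proof -
        have "0 \<le> (t - a)\<^sup>2 * poly r t"
          using v_nonneg[of t] that by (simp add: v_sq)
        moreover have "0 < (t - a)\<^sup>2"
          using that by simp
        ultimately show ?thesis
          by (simp only: zero_le_mult_iff) auto
      qed
      have "0 \<le> poly r a"
        using poly_nonneg_Icc_fill[OF \<open>c < d\<close> a r_nonneg] .
      then have "P r"
        using less.hyps[of r] deg_q deg_r r_nonneg by force
      then show ?thesis
        unfolding v_sq by (rule square)
    qed
    moreover have "P [:poly u a:]"
      using less.prems a const by blast
    ultimately show ?thesis
      using add u by metis
  qed
qed

text \<open>Arbitrary finite index sets allow sums and products of sums of squares to be indexed by
  disjoint unions and products.\<close>

lemma sphere_sosI: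
  assumes "finite A" and poly: "\<And>a. a \<in> A \<Longrightarrow> real_polynomial_function (g a)"
    and eq: "\<And>x. x \<in> sphere 0 1 \<Longrightarrow> h x = (\<Sum>a\<in>A. (g a x)\<^sup>2)"
  shows "sphere_sos (restrict h (sphere 0 1))"
proof -
  obtain e where e: "bij_betw e {..<card A} A"
    using ex_bij_betw_nat_finite[OF \<open>finite A\<close>] by (auto simp: atLeast0LessThan)
  have "h x = (\<Sum>i<card A. ((\<lambda>x\<in>sphere 0 1. g (e i) x) x)\<^sup>2)" if "x \<in> sphere 0 1" for x
    using sum.reindex_bij_betw[OF e, of "\<lambda>a. (g a x)\<^sup>2"] eq that by simp
  moreover have "(\<lambda>x\<in>sphere 0 1. g (e i) x) \<in> sphere_ring" if "i < card A" for i
    using poly bij_betwE[OF e] that by (auto simp: sphere_ring_def)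
  ultimately show ?thesis
    unfolding sphere_sos_def by (intro exI[of _ "card A"] exI[of _ "\<lambda>i. \<lambda>x\<in>sphere 0 1. g (e i) x"])
      (auto intro!: restrict_ext)
qed

text \<open>Choosing polynomial representatives of the ring elements lets sums and products be
  formed from total functions, without handling restrictions.\<close>

lemma sphere_sosE:
  assumes "sphere_sos (restrict h (sphere 0 1))"
  obtains m :: nat and g where "\<And>i. i < m \<Longrightarrow> real_polynomial_function (g i)"
    and "\<And>x. x \<in> sphere 0 1 \<Longrightarrow> h x = (\<Sum>i<m. (g i x)\<^sup>2)"
proof -
  obtain m and g where g: "\<forall>i<m. g i \<in> sphere_ring"
    and h: "restrict h (sphere 0 1) = (\<lambda>x\<in>sphere 0 1. \<Sum>i<(m::nat). (g i x)\<^sup>2)"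
    using assms unfolding sphere_sos_def by blast
  have "\<forall>i<m. \<exists>p. real_polynomial_function p \<and> g i = restrict p (sphere 0 1)"
    using g by (auto simp: sphere_ring_def)
  then obtain p where p: "\<And>i. i < m \<Longrightarrow> real_polynomial_function (p i)"
      "\<And>i. i < m \<Longrightarrow> g i = restrict (p i) (sphere 0 1)"
    by metis
  show thesis
  proof (rule that)
    show "real_polynomial_function (p i)" if "i < m" for i
      using p(1) that .
    show "h x = (\<Sum>i<m. (p i x)\<^sup>2)" if "x \<in> sphere 0 1" for x
      using fun_cong[OF h, of x] that p(2) by simp
  qed
qed

lemma sphere_sos_square:
  "real_polynomial_function p \<Longrightarrow> sphere_sos (\<lambda>x\<in>sphere 0 1. (p x)\<^sup>2)"
  by (rule sphere_sosI[of "{()}" "\<lambda>_. p"]) auto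

lemma sphere_sos_const:
  "0 \<le> k \<Longrightarrow> sphere_sos (\<lambda>x\<in>sphere 0 1. k)"
  using sphere_sos_square[of "\<lambda>_. sqrt k"] by (simp add: real_polynomial_function.intros)

lemma sphere_sos_add:
  assumes "sphere_sos (restrict h (sphere 0 1))" "sphere_sos (restrict k (sphere 0 1))"
  shows "sphere_sos (\<lambda>x\<in>sphere 0 1. h x + k x)"
proof -
  obtain m :: nat and p where p: "\<And>i. i < m \<Longrightarrow> real_polynomial_function (p i)"
    "\<And>x. x \<in> sphere 0 1 \<Longrightarrow> h x = (\<Sum>i<m. (p i x)\<^sup>2)"
    using assms(1) by (rule sphere_sosE) blast
  obtain n :: nat and q where q: "\<And>i. i < n \<Longrightarrow> real_polynomial_function (q i)"
    "\<And>x. x \<in> sphere 0 1 \<Longrightarrow> k x = (\<Sum>i<n. (q i x)\<^sup>2)"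
    using assms(2) by (rule sphere_sosE) blast
  show ?thesis
    by (rule sphere_sosI[of "{..<m} <+> {..<n}" "case_sum p q"]) (auto simp: p q sum.Plus)
qed

lemma sphere_sos_mult:
  assumes "sphere_sos (restrict h (sphere 0 1))" "sphere_sos (restrict k (sphere 0 1))"
  shows "sphere_sos (\<lambda>x\<in>sphere 0 1. h x * k x)"
proof -
  obtain m :: nat and p where p: "\<And>i. i < m \<Longrightarrow> real_polynomial_function (p i)"
    "\<And>x. x \<in> sphere 0 1 \<Longrightarrow> h x = (\<Sum>i<m. (p i x)\<^sup>2)"
    using assms(1) by (rule sphere_sosE) blast
  obtain n :: nat and q where q: "\<And>i. i < n \<Longrightarrow> real_polynomial_function (q i)"
    "\<And>x. x \<in> sphere 0 1 \<Longrightarrow> k x = (\<Sum>i<n. (q i x)\<^sup>2)"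
    using assms(2) by (rule sphere_sosE) blast
  show ?thesis
    by (rule sphere_sosI[of "{..<m} \<times> {..<n}" "\<lambda>(i, j) x. p i x * q j x"])
      (auto simp: p q sum_product sum.cartesian_product power_mult_distrib
        intro!: sum.cong)
qed

lemma sphere_sos_sum:
  assumes "finite A" "\<And>a. a \<in> A \<Longrightarrow> sphere_sos (restrict (h a) (sphere 0 1))"
  shows "sphere_sos (\<lambda>x\<in>sphere 0 1. \<Sum>a\<in>A. h a x)"
  using assms
  by (induction A rule: finite_induct) (auto intro: sphere_sos_add sphere_sos_const)

lemma real_polynomial_function_poly:
  "real_polynomial_function g \<Longrightarrow> real_polynomial_function (\<lambda>x. poly p (g x))"
  by (induction p) (auto intro: real_polynomial_function.intros)

lemma sphere_sos_one_minus_inner: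
  fixes y :: "real ^ 'n"
  assumes "y \<in> sphere 0 1"
  shows "sphere_sos (\<lambda>x\<in>sphere 0 1. 1 - x \<bullet> y)"
\<comment> \<open>For unit vectors the squared distance is \<open>2 - 2 * (x \<bullet> y)\<close>;
  the factor \<open>sqrt (1 / 2)\<close> moves the resulting one half inside the squares.\<close>
proof (rule sphere_sosI[of UNIV "\<lambda>i x. (x $ i - y $ i) * sqrt (1 / 2)"])
  show "real_polynomial_function (\<lambda>x. (x $ i - y $ i) * sqrt (1 / 2))" for i
    by (intro real_polynomial_function.intros real_polynomial_function_diff bounded_linear_vec_nth)
  fix x :: "real ^ 'n"
  assume "x \<in> sphere 0 1"
  then have "x \<bullet> x = 1" "y \<bullet> y = 1"
    using assms by (simp_all add: dot_square_norm)
  then have "1 - x \<bullet> y = (x - y) \<bullet> (x - y) / 2"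
    by (simp add: inner_diff_left inner_diff_right inner_commute)
  also have "\<dots> = (\<Sum>i\<in>UNIV. (x $ i - y $ i)\<^sup>2 * (1 / 2))"
    by (simp add: inner_vec_def power2_eq_square sum_divide_distrib)
  also have "\<dots> = (\<Sum>i\<in>UNIV. ((x $ i - y $ i) * sqrt (1 / 2))\<^sup>2)"
    by (simp add: power_mult_distrib real_sqrt_divide power_divide)
  finally show "1 - x \<bullet> y = (\<Sum>i\<in>UNIV. ((x $ i - y $ i) * sqrt (1 / 2))\<^sup>2)" .
qed simp

lemma sphere_sos_poly_inner:
  fixes y :: "real ^ 'n" and u :: "real poly"
  assumes "y \<in> sphere 0 1" and "\<forall>t\<in>{-1..1}. 0 \<le> poly u t"
  shows "sphere_sos (\<lambda>x\<in>sphere 0 1. poly u (x \<bullet> y))"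
proof -
  have "(-1 :: real) < 1"
    by simp
  from this assms(2) show ?thesis
  proof (induction u rule: poly_nonneg_Icc_induct)
    case (const k)
    from sphere_sos_const[OF const] show ?case
      by (simp add: restrict_def)
  next
    case (add p q)
    from sphere_sos_add[OF add] show ?case
      by (simp add: restrict_def)
  next
    case (square p q)
    have "real_polynomial_function (\<lambda>x. poly p (x \<bullet> y))"
      by (intro real_polynomial_function_poly real_polynomial_function.intros bounded_linear_inner_left)
    from sphere_sos_mult[OF sphere_sos_square[OF this] square] show ?case
      by (simp add: restrict_def)
  next
    case (left q)
    \<comment> \<open>The left factor is \<open>1 + x \<bullet> y\<close>, that is
      \<open>1 - x \<bullet> (- y)\<close>, and \<open>- y\<close> is again a unit vector.\<close>
    from sphere_sos_mult[OF sphere_sos_one_minus_inner[of "- y"] left] assms(1) show ?case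
      by (simp add: restrict_def algebra_simps)
  next
    case (right q)
    from sphere_sos_mult[OF sphere_sos_one_minus_inner[OF assms(1)] right] show ?case
      by (simp add: restrict_def algebra_simps)
  qed
qed

theorem theorem4p6:
  fixes u :: "real poly"
    and Y :: "(real ^ 'n) set"
    and W :: "real ^ 'n \<Rightarrow> real"
    and f :: "real ^ 'n \<Rightarrow> real"
  assumes "CARD('n) \<ge> 2"
    and "\<forall>t\<in>{-1..1}. poly u t \<ge> 0"
    and "quadrature_rule Y W"
    and "\<forall>y\<in>Y. f y \<ge> 0"
  shows "sphere_sos (approx_convolution Y W u f)"
  unfolding approx_convolution_def
proof (rule sphere_sos_sum)
  show "finite Y"
    using assms(3) by (simp add: quadrature_rule_def)
  fix y
  assume "y \<in> Y"
  then have y: "y \<in> sphere 0 1" "0 \<le> W y" "0 \<le> f y"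
    using assms(3,4) by (auto simp: quadrature_rule_def less_imp_le)
  have u: "sphere_sos (\<lambda>x\<in>sphere 0 1. poly u (x \<bullet> y))"
    using sphere_sos_poly_inner[OF y(1)] assms(2) by blast
  show "sphere_sos (\<lambda>x\<in>sphere 0 1. W y * poly u (x \<bullet> y) * f y)"
    \<comment> \<open>As functions of \<open>x\<close>, the weight \<open>W y\<close> and the value
      \<open>f y\<close> are nonnegative constants, hence squares.\<close>
    by (intro sphere_sos_mult sphere_sos_const u y)
qed

end
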